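(* Let $\mathbb{F}$ be an infinite field. (i) Every codimension two level sequence is log-concave: if $A$ is a graded Artinian level quotient of $\mathbb{F}[x,y]$ with $\dim_{\mathbb F}A_1=2$, then its Hilbert function is log-concave. (ii) Every compressed level Hilbert function, in any codimension, is log-concave: if $A$ is a compressed level algebra of codimension $r$, socle degree $j$ and type $t$, then its Hilbert function $H(A)=(H(A)_0,\ldots,H(A)_j)$ is log-concave.
   Context: Algebras are standard graded quotients $A=R/I$ of $R=\mathbb{F}[x_1,\ldots,x_r]$, with Hilbert function $H(A)_i=\dim_{\mathbb F}A_i$; the codimension is $r=H(A)_1$. The socle of an Artinian algebra $A$ is $(0:\mathfrak m_A)$, with $\mathfrak m_A$ its maximal (homogeneous) ideal. A graded Artinian algebra $A$ with highest nonzero degree $j$ (its socle degree) is level, of type $t=\dim_{\mathbb F}A_j$, if $(0:\mathfrak m_A)=A_j$. A level sequence is the Hilbert function of a level algebra. A compressed level algebra of codimension $r$, socle degree $j$ and type $t$ is a level algebra with these invariants whose Hilbert function is $H(A)_i=\min\{r_i,\,t\,r_{j-i}\}$ for $0\le i\le j$, where $r_i=\dim_{\mathbb F}R_i=\binom{r+i-1}{i}$. A finite sequence $(h_0,\ldots,h_j)$ is log-concave if $h_{i-1}h_{i+1}\le h_i^2$ for all $1\le i\le j-1$. *)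

theory Defs
  imports "HOL-Library.Poly_Mapping" "HOL-Algebra.QuotRing" "Jordan_Normal_Form.VS_Connect"
begin

text \<open>
  Monomials are finitely supported exponent vectors, polynomials are finitely supported
  coefficient functions on monomials; the product of \<^theory>\<open>HOL-Library.Poly_Mapping\<close>
  is convolution.
\<close>

type_synonym monom = "nat \<Rightarrow>\<^sub>0 nat"
type_synonym 'k mpoly = "monom \<Rightarrow>\<^sub>0 'k"

definition mon_deg :: "monom \<Rightarrow> nat" where
  "mon_deg m = (\<Sum>v\<in>Poly_Mapping.keys m. Poly_Mapping.lookup m v)"

text \<open>The \<open>'k\<close>-algebra \<open>R\<close> of polynomials in the \<open>r\<close> variables with indices \<open>0, \<dots>, r - 1\<close>.\<close>

definition poly_alg :: "nat \<Rightarrow> ('k::field, 'k mpoly) module" where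
  "poly_alg r =
    \<lparr> carrier = {p. \<forall>m\<in>Poly_Mapping.keys p. Poly_Mapping.keys m \<subseteq> {..<r}},
      mult = (*), one = 1, zero = 0, add = (+),
      smult = (\<lambda>c p. Poly_Mapping.single 0 c * p) \<rparr>"

definition poly_piece :: "nat \<Rightarrow> nat \<Rightarrow> 'k::field mpoly set" where
  "poly_piece r i = {p \<in> carrier (poly_alg r). \<forall>m\<in>Poly_Mapping.keys p. mon_deg m = i}"

definition hom_component :: "nat \<Rightarrow> 'k::field mpoly \<Rightarrow> 'k mpoly" where
  "hom_component i p =
    (\<Sum>m\<in>{m \<in> Poly_Mapping.keys p. mon_deg m = i}.
       Poly_Mapping.single m (Poly_Mapping.lookup p m))"

definition homogeneous_ideal :: "nat \<Rightarrow> 'k::field mpoly set \<Rightarrow> bool" where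
  "homogeneous_ideal r I \<longleftrightarrow>
     ideal I (poly_alg r) \<and> (\<forall>p\<in>I. \<forall>i. hom_component i p \<in> I)"

text \<open>
  The graded algebra \<open>A = R/I\<close>: the factor ring, whose elements are cosets, with the induced
  scalar multiplication, and its homogeneous pieces \<open>A\<^sub>i\<close>, the images of the \<open>R\<^sub>i\<close>.
\<close>

definition quot_alg :: "nat \<Rightarrow> 'k::field mpoly set \<Rightarrow> ('k, 'k mpoly set) module" where
  "quot_alg r I =
     ring.extend (poly_alg r Quot I)
       (module.fields (\<lambda>c X. \<Union>p\<in>X. I +>\<^bsub>poly_alg r\<^esub> (c \<odot>\<^bsub>poly_alg r\<^esub> p)))"

definition quot_piece :: "nat \<Rightarrow> 'k::field mpoly set \<Rightarrow> nat \<Rightarrow> 'k mpoly set set" where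
  "quot_piece r I i = (\<lambda>p. I +>\<^bsub>poly_alg r\<^esub> p) ` poly_piece r i"

definition hilb :: "nat \<Rightarrow> 'k::field mpoly set \<Rightarrow> nat \<Rightarrow> nat" where
  "hilb r I i =
     vectorspace.dim (class_ring :: 'k ring) (quot_alg r I \<lparr>carrier := quot_piece r I i\<rparr>)"

definition artinian_ring :: "('a, 'b) ring_scheme \<Rightarrow> bool" where
  "artinian_ring A \<longleftrightarrow> cring A \<and>
     (\<forall>J :: nat \<Rightarrow> 'a set. (\<forall>n. ideal (J n) A) \<and> (\<forall>n. J (Suc n) \<subseteq> J n)
        \<longrightarrow> (\<exists>N. \<forall>n\<ge>N. J n = J N))"

text \<open>\<open>\<Oplus>\<^sub>i\<^sub>\<ge>\<^sub>1 A\<^sub>i\<close>, as the ideal generated by the homogeneous elements of positive degree.\<close>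

definition max_hom_ideal :: "nat \<Rightarrow> 'k::field mpoly set \<Rightarrow> 'k mpoly set set" where
  "max_hom_ideal r I = genideal (quot_alg r I) (\<Union>i\<in>{1..}. quot_piece r I i)"

definition socle :: "nat \<Rightarrow> 'k::field mpoly set \<Rightarrow> 'k mpoly set set" where
  "socle r I = {a \<in> carrier (quot_alg r I).
     \<forall>b\<in>max_hom_ideal r I. a \<otimes>\<^bsub>quot_alg r I\<^esub> b = \<zero>\<^bsub>quot_alg r I\<^esub>}"

definition socle_degree :: "nat \<Rightarrow> 'k::field mpoly set \<Rightarrow> nat \<Rightarrow> bool" where
  "socle_degree r I j \<longleftrightarrow>
     quot_piece r I j \<noteq> {\<zero>\<^bsub>quot_alg r I\<^esub>} \<and>
     (\<forall>i>j. quot_piece r I i = {\<zero>\<^bsub>quot_alg r I\<^esub>})"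

text \<open>\<open>R/I\<close> is a graded Artinian level algebra of socle degree \<open>j\<close> and type \<open>t\<close>.\<close>

definition level_algebra :: "nat \<Rightarrow> 'k::field mpoly set \<Rightarrow> nat \<Rightarrow> nat \<Rightarrow> bool" where
  "level_algebra r I j t \<longleftrightarrow>
     homogeneous_ideal r I \<and> artinian_ring (quot_alg r I) \<and> socle_degree r I j \<and>
     hilb r I j = t \<and> socle r I = quot_piece r I j"

text \<open>
  \<open>dim R\<^sub>i\<close>. Truncated subtraction is harmless: for \<open>r = 0\<close> this is \<open>1\<close> if \<open>i = 0\<close>,
  and \<open>0\<close> otherwise.
\<close>

definition poly_dim :: "nat \<Rightarrow> nat \<Rightarrow> nat" where
  "poly_dim r i = (r + i - 1) choose i"

definition compressed_level_algebra ::
    "nat \<Rightarrow> 'k::field mpoly set \<Rightarrow> nat \<Rightarrow> nat \<Rightarrow> bool" where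
  "compressed_level_algebra r I j t \<longleftrightarrow>
     level_algebra r I j t \<and> hilb r I 1 = r \<and>
     (\<forall>i\<le>j. hilb r I i = min (poly_dim r i) (t * poly_dim r (j - i)))"

text \<open>Log-concavity of the finite sequence \<open>(h 0, \<dots>, h j)\<close>.\<close>

definition log_concave :: "(nat \<Rightarrow> nat) \<Rightarrow> nat \<Rightarrow> bool" where
  "log_concave h j \<longleftrightarrow> (\<forall>i. 1 \<le> i \<and> i < j \<longrightarrow> h (i - 1) * h (i + 1) \<le> (h i)\<^sup>2)"

end

theory Submission
  imports Defs
begin

text \<open>
  In a level quotient \<open>A\<close> of \<open>F[x, y]\<close> of socle degree \<open>j\<close>, no nonzero element of degree \<open>i < j\<close>
  is annihilated by both variables. So in the complex
  \<open>0 \<rightarrow> A\<^sub>i \<rightarrow> A\<^sub>i\<^sub>+\<^sub>1 \<oplus> A\<^sub>i\<^sub>+\<^sub>1 \<rightarrow> A\<^sub>i\<^sub>+\<^sub>2 \<rightarrow> 0\<close> with the maps \<open>a \<mapsto> (y a, - x a)\<close> and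
  \<open>(b, c) \<mapsto> x b + y c\<close> the first map is injective and the second one surjective. Counting
  dimensions, the Hilbert function is concave, hence log-concave. In the compressed case it is
  the minimum of the two log-concave sequences \<open>r\<^sub>i\<close> and \<open>t r\<^sub>j\<^sub>-\<^sub>i\<close>.
\<close>

section \<open>Linear algebra\<close>

lemma (in mod_hom) image_span_subset:
  assumes "A \<subseteq> carrier M"
  shows "f ` M.span A \<subseteq> N.span (f ` A)"
proof -
  have fA: "f ` A \<subseteq> carrier N" using assms by auto
  interpret S: submodule R "N.span (f ` A)" N by (rule N.span_is_submodule[OF fA])
  have "submodule R {v \<in> carrier M. f v \<in> N.span (f ` A)} M"
    by unfold_locales (auto)
  moreover have "A \<subseteq> {v \<in> carrier M. f v \<in> N.span (f ` A)}"
    using assms N.in_own_span[OF fA] by auto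
  ultimately have "M.span A \<subseteq> {v \<in> carrier M. f v \<in> N.span (f ` A)}"
    by (intro M.span_is_subset)
  then show ?thesis by auto
qed

text \<open>An independent subset of \<open>X\<close> stays independent in \<open>V\<close>, so its
  size is at most \<open>dim\<close>. This bound yields a finite maximal independent subset of
  \<open>X\<close>, which is a basis.\<close>

lemma (in vectorspace) subspace_fin_dim:
  assumes "subspace K X V" "fin_dim"
  shows "vectorspace.fin_dim K (vs X)" "vectorspace.dim K (vs X) \<le> dim"
proof -
  interpret X: vectorspace K "vs X" by (rule subspace_is_vs[OF assms(1)])
  have XV: "X \<subseteq> carrier V" using assms(1) by (auto simp: subspace_def submodule_def)
  have li: "lin_indpt A" if "A \<subseteq> X" "X.lin_indpt A" for A
    using span_li_not_depend(2)[OF that(1) is_module[OF assms(1)]] that(2) by simp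
  have *: "finite A \<and> card A \<le> dim" if "A \<subseteq> X" "X.lin_indpt A" for A
    using li_le_dim[OF assms(2) _ li[OF that]] that XV by auto
  \<comment> \<open>The empty set starts the search, and \<open>dim\<close> bounds how far it can
    grow.\<close>
  have "\<exists>A. finite A \<and> maximal A (\<lambda>S. S \<subseteq> carrier (vs X) \<and> X.lin_indpt S)"
    by (rule maximal_exists[where N = dim and B = "{}"])
       (use * in \<open>auto simp: X.lin_dep_def\<close>)
  then obtain A where A: "finite A" "maximal A (\<lambda>S. S \<subseteq> carrier (vs X) \<and> X.lin_indpt S)"
    by blast
  then have b: "X.basis A" by (intro X.max_li_is_basis) auto
  then show "X.fin_dim" using A(1) unfolding X.fin_dim_def X.basis_def by auto
  show "X.dim \<le> dim"
    using X.dim_basis[OF A(1) b] * b unfolding X.basis_def by auto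
qed

text \<open>By rank-nullity with trivial kernel, \<open>V.dim\<close> is the dimension of the image,
  a subspace of \<open>W\<close>.\<close>

lemma (in linear_map) injective_dim_le:
  assumes "V.fin_dim" "W.fin_dim" "inj_on T (carrier V)"
  shows "V.dim \<le> W.dim"
  using rank_nullity[OF assms(1)] inj_imp_dim_ker0[OF assms(3)]
    W.subspace_fin_dim(2)[OF imT_is_subspace assms(2)] by simp

lemma direct_sum_simps [simp]:
  "carrier (direct_sum M N) = carrier M \<times> carrier N"
  "x \<oplus>\<^bsub>direct_sum M N\<^esub> y = (fst x \<oplus>\<^bsub>M\<^esub> fst y, snd x \<oplus>\<^bsub>N\<^esub> snd y)"
  "\<zero>\<^bsub>direct_sum M N\<^esub> = (\<zero>\<^bsub>M\<^esub>, \<zero>\<^bsub>N\<^esub>)"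
  "c \<odot>\<^bsub>direct_sum M N\<^esub> x = (c \<odot>\<^bsub>M\<^esub> fst x, c \<odot>\<^bsub>N\<^esub> snd x)"
  by (simp_all add: direct_sum_def)

lemma linear_mapI:
  assumes "vectorspace K V" "vectorspace K W"
    and "\<And>v. v \<in> carrier V \<Longrightarrow> f v \<in> carrier W"
    and "\<And>v w. v \<in> carrier V \<Longrightarrow> w \<in> carrier V \<Longrightarrow> f (v \<oplus>\<^bsub>V\<^esub> w) = f v \<oplus>\<^bsub>W\<^esub> f w"
    and "\<And>c v. c \<in> carrier K \<Longrightarrow> v \<in> carrier V \<Longrightarrow> f (c \<odot>\<^bsub>V\<^esub> v) = c \<odot>\<^bsub>W\<^esub> f v"
  shows "linear_map K V W f"
  using assms
  by (auto simp: linear_map_def mod_hom_def mod_hom_axioms_def vectorspace_def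
      LinearCombinations.module_hom_def)

text \<open>Spanning sets of the summands, embedded by the two injections, together span the sum.
  The dimension comes from rank-nullity for the second projection: its image is \<open>W\<close> and
  its kernel is a copy of \<open>V\<close>.\<close>

lemma
  fixes V :: "('a, 'b) module" and W :: "('a, 'c) module"
  assumes V: "vectorspace K V" and W: "vectorspace K W"
    and finV: "vectorspace.fin_dim K V" and finW: "vectorspace.fin_dim K W"
  shows direct_sum_fin_dim: "vectorspace.fin_dim K (direct_sum V W)"
    and direct_sum_dim:
      "vectorspace.dim K (direct_sum V W) = vectorspace.dim K V + vectorspace.dim K W"
proof -
  interpret V: vectorspace K V by (rule V)
  interpret W: vectorspace K W by (rule W)
  interpret D: vectorspace K "direct_sum V W" by (rule direct_sum_is_vs[OF V W])
  interpret i1: linear_map K V "direct_sum V W" "inj1 V W" by (rule inj1_linear[OF V W])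
  interpret i2: linear_map K W "direct_sum V W" "inj2 V W" by (rule inj2_linear[OF V W])
  obtain A where A: "finite A" "A \<subseteq> carrier V" "V.span A = carrier V"
    using finV unfolding V.fin_dim_def by auto
  obtain B where B: "finite B" "B \<subseteq> carrier W" "W.span B = carrier W"
    using finW unfolding W.fin_dim_def by auto
  define S where "S = inj1 V W ` A \<union> inj2 V W ` B"
  have S: "finite S" "S \<subseteq> carrier (direct_sum V W)"
    using A B by (auto simp: S_def inj1_def inj2_def)
  interpret span: submodule K "D.span S" "direct_sum V W" by (rule D.span_is_submodule[OF S(2)])
  have "D.span S = carrier (direct_sum V W)"
  proof
    show "carrier (direct_sum V W) \<subseteq> D.span S"
    proof
      fix x assume x: "x \<in> carrier (direct_sum V W)"
      have "inj1 V W (fst x) \<in> D.span (inj1 V W ` A)"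
        using i1.image_span_subset[OF A(2)] A(3) x by auto
      moreover have "inj2 V W (snd x) \<in> D.span (inj2 V W ` B)"
        using i2.image_span_subset[OF B(2)] B(3) x by auto
      ultimately have "inj1 V W (fst x) \<oplus>\<^bsub>direct_sum V W\<^esub> inj2 V W (snd x) \<in> D.span S"
        using D.span_is_monotone[of "inj1 V W ` A" S] D.span_is_monotone[of "inj2 V W ` B" S]
        by (intro span.m_closed) (auto simp: S_def)
      then show "x \<in> D.span S" using x by (auto simp: inj1_def inj2_def)
    qed
  qed (rule span.subset)
  then show fin: "D.fin_dim" using S unfolding D.fin_dim_def by blast
  interpret p: linear_map K "direct_sum V W" W snd
    by (rule linear_mapI[OF D.vectorspace_axioms W]) auto
  interpret ker: vectorspace K "D.vs p.kerT" by (rule D.subspace_is_vs[OF p.kerT_is_subspace])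
  \<comment> \<open>The first injection, with codomain cut down to the kernel of \<open>snd\<close>,
    is a linear bijection.\<close>
  interpret k: linear_map K V "D.vs p.kerT" "inj1 V W"
    by (rule linear_mapI[OF V ker.vectorspace_axioms]) (auto simp: inj1_def p.ker_def)
  have "V.dim = ker.dim"
    by (rule k.dim_eq[OF finV]) (auto simp: inj_on_def inj1_def p.ker_def image_def)
  moreover have "p.imT = carrier W"
    by (auto simp: p.im_def image_def)
  ultimately show "D.dim = V.dim + W.dim"
    using p.rank_nullity[OF fin] by simp
qed

text \<open>Since \<open>g\<close> vanishes on the image of \<open>f\<close>, the injection
  \<open>f\<close> lands in the kernel of \<open>g\<close>, whose dimension is
  \<open>dim V - dim W\<close> by surjectivity. Only an inequality results, as the image of
  \<open>f\<close> may be smaller than that kernel.\<close>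

lemma dim_add_le_of_complex:
  assumes V: "vectorspace K V"
    and f: "linear_map K U V f" and g: "linear_map K V W g"
    and fin: "vectorspace.fin_dim K U" "vectorspace.fin_dim K V"
    and inj: "inj_on f (carrier U)" and surj: "g ` carrier V = carrier W"
    and zero: "\<And>u. u \<in> carrier U \<Longrightarrow> g (f u) = \<zero>\<^bsub>W\<^esub>"
  shows "vectorspace.dim K U + vectorspace.dim K W \<le> vectorspace.dim K V"
proof -
  interpret f: linear_map K U V f by (rule f)
  interpret g: linear_map K V W g by (rule g)
  interpret ker: vectorspace K "f.W.vs g.kerT"
    by (rule f.W.subspace_is_vs[OF g.kerT_is_subspace])
  interpret k: linear_map K U "f.W.vs g.kerT" f
    by (rule linear_mapI[OF f.V.vectorspace_axioms ker.vectorspace_axioms])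
       (auto simp: g.ker_def zero)
  have "f.V.dim \<le> ker.dim"
    using f.W.subspace_fin_dim(1)[OF g.kerT_is_subspace fin(2)] fin(1) inj
    by (intro k.injective_dim_le)
  then show ?thesis
    using g.rank_nullity[OF fin(2)] surj by (simp add: g.im_def)
qed

section \<open>Log-concavity of numerical sequences\<close>

text \<open>For positive \<open>r\<close> the ratio of consecutive terms is
  \<open>(r + i) / (i + 1)\<close>, which does not increase with \<open>i\<close>. The argument is
  cross-multiplied to stay within the naturals.\<close>

lemma poly_dim_log_concave: "poly_dim r i * poly_dim r (i + 2) \<le> (poly_dim r (i + 1))\<^sup>2"
proof (cases r)
  case 0
  then show ?thesis by (simp add: poly_dim_def binomial_eq_0)
next
  case (Suc s)
  let ?a = "poly_dim r i" and ?b = "poly_dim r (i + 1)" and ?c = "poly_dim r (i + 2)"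
  have b: "(i + 1) * ?b = (r + i) * ?a"
    using Suc_times_binomial_eq[of "s + i" i] by (simp add: Suc poly_dim_def)
  have c: "(i + 2) * ?c = (r + i + 1) * ?b"
    using Suc_times_binomial_eq[of "s + i + 1" "i + 1"] by (simp add: Suc poly_dim_def)
  have "((r + i) * (i + 2)) * (?a * ?c) = ((r + i) * ?a) * ((i + 2) * ?c)"
    by (simp only: mult_ac)
  also have "\<dots> = ((i + 1) * ?b) * ((r + i + 1) * ?b)"
    by (simp only: b c)
  also have "\<dots> = ((i + 1) * (r + i + 1)) * ?b\<^sup>2"
    by (simp only: power2_eq_square mult_ac)
  \<comment> \<open>\<open>(r + i) * (i + 2)\<close> exceeds \<open>(i + 1) * (r + i + 1)\<close> by
    exactly \<open>r - 1\<close>.\<close>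
  also have "\<dots> \<le> ((r + i) * (i + 2)) * ?b\<^sup>2"
    by (intro mult_right_mono) (auto simp: Suc algebra_simps)
  finally have "((r + i) * (i + 2)) * (?a * ?c) \<le> ((r + i) * (i + 2)) * ?b\<^sup>2" .
  moreover have "0 < (r + i) * (i + 2)" by (simp add: Suc)
  ultimately show ?thesis by (simp only: mult_le_cancel1 simp_thms)
qed

text \<open>The product of minima is below both \<open>a * c\<close> and \<open>a' * c'\<close>, so
  whichever of \<open>b\<close> and \<open>b'\<close> is smaller, the matching hypothesis
  applies.\<close>

lemma log_concave_min:
  fixes a b c a' b' c' :: nat
  assumes "a * c \<le> b\<^sup>2" "a' * c' \<le> b'\<^sup>2"
  shows "min a a' * min c c' \<le> (min b b')\<^sup>2"
proof -
  have "min a a' * min c c' \<le> a * c" "min a a' * min c c' \<le> a' * c'"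
    by (intro mult_mono; simp)+
  then show ?thesis using assms by (auto simp: min_def)
qed

lemma compressed_log_concave:
  assumes "compressed_level_algebra r I j t"
  shows "log_concave (hilb r I) j"
  unfolding log_concave_def
proof (intro allI impI)
  fix i assume i: "1 \<le> i \<and> i < j"
  \<comment> \<open>With \<open>i = k + 1\<close> and \<open>j = k + d + 2\<close>, the three
    arguments \<open>j - l\<close> become \<open>d + 2\<close>, \<open>d + 1\<close> and
    \<open>d\<close>, free of truncated subtraction.\<close>
  define k d where "k = i - 1" and "d = j - i - 1"
  then have i: "i = k + 1" and j: "j = k + d + 2" using i by auto
  have h: "hilb r I l = min (poly_dim r l) (t * poly_dim r (j - l))" if "l \<le> j" for l
    using assms that by (simp add: compressed_level_algebra_def)
  \<comment> \<open>Log-concavity is invariant under reversing the sequence and scaling it by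
    \<open>t\<close>.\<close>
  have "(t * poly_dim r (d + 2)) * (t * poly_dim r d) \<le> (t * poly_dim r (d + 1))\<^sup>2"
    using mult_left_mono[OF poly_dim_log_concave[of r d], of "t * t"]
    by (simp add: power2_eq_square mult_ac)
  from log_concave_min[OF poly_dim_log_concave[of r k] this]
  show "hilb r I (i - 1) * hilb r I (i + 1) \<le> (hilb r I i)\<^sup>2"
    using h[of k] h[of "k + 1"] h[of "k + 2"] by (simp add: i j)
qed

text \<open>The arithmetic-geometric mean inequality, from \<open>(a - b)^2 \<ge> 0\<close>; the
  integers supply a genuine subtraction.\<close>

lemma mult_le_square_if_add_le:
  fixes a b h :: nat
  assumes "a + b \<le> 2 * h"
  shows "a * b \<le> h\<^sup>2"
proof -
  have "4 * (int a * int b) \<le> (int a + int b)\<^sup>2"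
    using zero_le_power2[of "int a - int b"] by (simp add: power2_eq_square algebra_simps)
  also have "\<dots> \<le> (2 * int h)\<^sup>2"
    using assms by (intro power_mono) auto
  finally have "int (a * b) \<le> int (h\<^sup>2)" by (simp add: power2_eq_square)
  then show ?thesis by linarith
qed

section \<open>Homogeneous polynomials\<close>

text \<open>Allows the degrees of several monomials to be summed over one common index set.\<close>

lemma mon_deg_eq_sum:
  assumes "finite S" "Poly_Mapping.keys m \<subseteq> S"
  shows "mon_deg m = (\<Sum>v\<in>S. Poly_Mapping.lookup m v)"
  unfolding mon_deg_def using assms
  by (intro sum.mono_neutral_left) (auto simp: in_keys_iff)

lemma mon_deg_add: "mon_deg (m + n) = mon_deg m + mon_deg n"
proof -
  let ?S = "Poly_Mapping.keys m \<union> Poly_Mapping.keys n"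
  have "mon_deg (m + n) = (\<Sum>v\<in>?S. Poly_Mapping.lookup (m + n) v)"
    by (rule mon_deg_eq_sum) (use keys_add[of m n] in auto)
  then show ?thesis
    by (simp add: lookup_add sum.distrib mon_deg_eq_sum[of ?S m] mon_deg_eq_sum[of ?S n])
qed

lemma mon_deg_eq_0_iff: "mon_deg m = 0 \<longleftrightarrow> m = 0"
  by (auto simp: mon_deg_def in_keys_iff intro: poly_mapping_eqI)

lemma mon_deg_single [simp]: "mon_deg (Poly_Mapping.single v k) = k"
  by (simp add: mon_deg_def)

lemma lookup_hom_component:
  "Poly_Mapping.lookup (hom_component i p) m = (if mon_deg m = i then Poly_Mapping.lookup p m else 0)"
  by (auto simp: hom_component_def lookup_sum lookup_single when_def in_keys_iff sum.delta)

lemma sum_monomials: "(\<Sum>m\<in>Poly_Mapping.keys p. Poly_Mapping.single m (Poly_Mapping.lookup p m)) = p"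
  by (rule poly_mapping_eqI) (auto simp: lookup_sum lookup_single when_def in_keys_iff sum.delta)

abbreviation var :: "nat \<Rightarrow> 'k::field mpoly" where
  "var v \<equiv> Poly_Mapping.single (Poly_Mapping.single v 1) 1"

abbreviation const :: "'k::field \<Rightarrow> 'k mpoly" where
  "const c \<equiv> Poly_Mapping.single 0 c"

lemma poly_piece_subset: "poly_piece r i \<subseteq> carrier (poly_alg r)"
  by (auto simp: poly_piece_def)

lemma poly_alg_simps [simp]:
  "x \<otimes>\<^bsub>poly_alg r\<^esub> y = x * y" "\<one>\<^bsub>poly_alg r\<^esub> = 1" "\<zero>\<^bsub>poly_alg r\<^esub> = 0"
  "x \<oplus>\<^bsub>poly_alg r\<^esub> y = x + y" "c \<odot>\<^bsub>poly_alg r\<^esub> x = const c * x"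
  by (simp_all add: poly_alg_def)

lemma poly_piece_0 [simp]: "0 \<in> poly_piece r i"
  by (simp add: poly_piece_def poly_alg_def)

lemma poly_piece_add:
  assumes "p \<in> poly_piece r i" "q \<in> poly_piece r i"
  shows "p + q \<in> poly_piece r i"
  using assms keys_add[of p q] by (fastforce simp: poly_piece_def poly_alg_def)

text \<open>Natural exponents cannot cancel, so the general inclusion for supports of sums is an
  equality here.\<close>

lemma keys_monom_add: 
  fixes m n :: monom
  shows "Poly_Mapping.keys (m + n) = Poly_Mapping.keys m \<union> Poly_Mapping.keys n"
  by (auto simp: in_keys_iff lookup_add)

lemma poly_piece_mult:
  assumes "p \<in> poly_piece r i" "q \<in> poly_piece r k"
  shows "p * q \<in> poly_piece r (i + k)"
  using assms keys_mult[of p q]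
  by (fastforce simp: poly_piece_def poly_alg_def keys_monom_add mon_deg_add)

lemma const_in_poly_piece: "const c \<in> poly_piece r 0"
  by (auto simp: poly_piece_def poly_alg_def mon_deg_def)

lemma var_in_poly_piece: "v < r \<Longrightarrow> var v \<in> poly_piece r 1"
  by (auto simp: poly_piece_def poly_alg_def)

lemma poly_piece_0_const:
  assumes "p \<in> poly_piece r 0"
  shows "p = const (Poly_Mapping.lookup p 0)"
proof (rule poly_mapping_eqI)
  fix m
  show "Poly_Mapping.lookup p m = Poly_Mapping.lookup (const (Poly_Mapping.lookup p 0)) m"
    using assms
    by (cases "m = 0") (auto simp: poly_piece_def mon_deg_eq_0_iff lookup_single when_def in_keys_iff)
qed

lemma poly_piece_induct [consumes 1, case_names zero add monomial]:
  assumes "p \<in> poly_piece r i" "Q 0" "\<And>p q. Q p \<Longrightarrow> Q q \<Longrightarrow> Q (p + q)"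
    and "\<And>m c. Poly_Mapping.keys m \<subseteq> {..<r} \<Longrightarrow> mon_deg m = i \<Longrightarrow> Q (Poly_Mapping.single m c)"
  shows "Q p"
proof -
  \<comment> \<open>Generalised from the full support of \<open>p\<close> to its subsets, so that
    finite set induction applies.\<close>
  have "Q (\<Sum>m\<in>K. Poly_Mapping.single m (Poly_Mapping.lookup p m))"
    if "finite K" "K \<subseteq> Poly_Mapping.keys p" for K
    using that
  proof (induction K)
    case (insert m K)
    then have "Q (Poly_Mapping.single m (Poly_Mapping.lookup p m))"
      using assms(1) by (intro assms(4)) (auto simp: poly_piece_def poly_alg_def)
    then show ?case using insert assms(3) by simp
  qed (simp add: assms(2))
  from this[of "Poly_Mapping.keys p"] show ?thesis by (simp add: sum_monomials)
qed

text \<open>Every monomial of positive degree in two variables is divisible by one of them; sums are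
  handled by linearity. The decomposition need not be unique.\<close>

lemma poly_piece_Suc_decompose:
  assumes "p \<in> poly_piece 2 (Suc i)"
  obtains q s where "q \<in> poly_piece 2 i" "s \<in> poly_piece 2 i" "p = var 0 * q + var 1 * s"
proof -
  have "\<exists>q\<in>poly_piece 2 i. \<exists>s\<in>poly_piece 2 i. p = var 0 * q + var 1 * s"
    using assms
  proof (induction rule: poly_piece_induct)
    case zero
    show ?case by (intro bexI[of _ 0]) auto
  next
    case (add p p')
    then obtain q s q' s' where
      *: "q \<in> poly_piece 2 i" "s \<in> poly_piece 2 i" "p = var 0 * q + var 1 * s"
      "q' \<in> poly_piece 2 i" "s' \<in> poly_piece 2 i" "p' = var 0 * q' + var 1 * s'" by blast
    have "p + p' = var 0 * (q + q') + var 1 * (s + s')"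
      using * by (simp add: algebra_simps)
    then show ?case using * poly_piece_add by blast
  next
    case (monomial m c)
    then have "m \<noteq> 0" using mon_deg_eq_0_iff[of m] by auto
    then obtain v where v: "v \<in> Poly_Mapping.keys m" by (metis keys_eq_empty all_not_in_conv)
    define n where "n = m - Poly_Mapping.single v 1"
    \<comment> \<open>The pointwise truncated subtraction in \<open>n\<close> loses nothing because
      \<open>v\<close> occurs in \<open>m\<close>.\<close>
    have m: "m = Poly_Mapping.single v 1 + n"
      using v by (intro poly_mapping_eqI)
        (auto simp: n_def lookup_add lookup_minus lookup_single when_def in_keys_iff)
    then have n: "mon_deg n = i" "Poly_Mapping.keys n \<subseteq> {..<2}"
      using monomial by (auto simp: mon_deg_add keys_monom_add)
    then have "Poly_Mapping.single n c \<in> poly_piece 2 i"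
      by (auto simp: poly_piece_def poly_alg_def)
    moreover have "Poly_Mapping.single m c = var v * Poly_Mapping.single n c"
      by (simp add: m mult_single)
    moreover have "v = 0 \<or> v = 1" using v monomial by auto
    \<comment> \<open>The variable other than \<open>v\<close> gets the coefficient
      \<open>0\<close>.\<close>
    ultimately show ?case
      by (metis add_0 add_0_right mult_zero_right poly_piece_0)
  qed
  then show ?thesis using that by blast
qed

section \<open>The polynomial algebra as a commutative ring\<close>

lemma poly_alg_add_closed:
  assumes "p \<in> carrier (poly_alg r)" "q \<in> carrier (poly_alg r)"
  shows "p + q \<in> carrier (poly_alg r)"
  using assms keys_add[of p q] by (fastforce simp: poly_alg_def)

lemma poly_alg_mult_closed:
  assumes "p \<in> carrier (poly_alg r)" "q \<in> carrier (poly_alg r)"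
  shows "p * q \<in> carrier (poly_alg r)"
  using assms keys_mult[of p q] by (fastforce simp: poly_alg_def keys_monom_add)

lemma poly_alg_uminus_closed:
  assumes "p \<in> carrier (poly_alg r)"
  shows "- p \<in> carrier (poly_alg r)"
  using assms by (auto simp: poly_alg_def in_keys_iff)

lemma poly_alg_01_closed: "0 \<in> carrier (poly_alg r)" "1 \<in> carrier (poly_alg r)"
  by (simp_all add: poly_alg_def)

lemma poly_alg_cring: "cring (poly_alg r)"
proof (intro cringI abelian_groupI comm_monoidI)
  show "\<exists>q\<in>carrier (poly_alg r). q \<oplus>\<^bsub>poly_alg r\<^esub> p = \<zero>\<^bsub>poly_alg r\<^esub>"
    if "p \<in> carrier (poly_alg r)" for p
    using poly_alg_uminus_closed[OF that] by (intro bexI[of _ "- p"]) auto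
qed (auto simp: poly_alg_add_closed poly_alg_mult_closed poly_alg_01_closed algebra_simps)

section \<open>Graded quotients\<close>

lemma ring_extend_simps [simp]:
  "carrier (ring.extend R m) = carrier R" "mult (ring.extend R m) = mult R"
  "one (ring.extend R m) = one R" "zero (ring.extend R m) = zero R" "add (ring.extend R m) = add R"
  by (simp_all add: ring.defs)

text \<open>The ring axioms mention only the ring fields, so attaching a scalar multiplication to
  the factor ring preserves them.\<close>

lemma cring_extend:
  assumes "cring R"
  shows "cring (ring.extend R m)"
proof -
  interpret cring R by (rule assms)
  show ?thesis
    by (intro cringI abelian_groupI comm_monoidI)
      (auto simp: a_ac m_ac l_distr r_distr intro: l_neg)
qed

locale graded_quotient =
  fixes r :: nat and I :: "'k::field mpoly set"
  assumes homogeneous: "homogeneous_ideal r I"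
begin

sublocale P: cring "poly_alg r" by (rule poly_alg_cring)

sublocale I: ideal I "poly_alg r"
  using homogeneous by (simp add: homogeneous_ideal_def)

abbreviation Q where "Q \<equiv> quot_alg r I"

abbreviation cls :: "'k mpoly \<Rightarrow> 'k mpoly set" where
  "cls p \<equiv> I +>\<^bsub>poly_alg r\<^esub> p"

lemma poly_alg_uminus: "p \<in> carrier (poly_alg r) \<Longrightarrow> \<ominus>\<^bsub>poly_alg r\<^esub> p = - p"
  by (rule P.minus_equality) (auto simp: poly_alg_uminus_closed)

section \<open>Arithmetic of cosets and the vector space structure\<close>

lemma cls_eq_iff:
  assumes "p \<in> carrier (poly_alg r)" "q \<in> carrier (poly_alg r)"
  shows "cls p = cls q \<longleftrightarrow> p - q \<in> I"
  using P.quotient_eq_iff_same_a_r_cos[OF I.is_ideal assms] assms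
  by (simp add: a_minus_def poly_alg_uminus)

sublocale Q: cring Q
  unfolding quot_alg_def by (intro cring_extend I.quotient_is_cring P.is_cring)

lemma carrier_Q: "carrier Q = cls ` carrier (poly_alg r)"
  by (auto simp: quot_alg_def FactRing_def A_RCOSETS_def RCOSETS_def a_r_coset_def)

lemma cls_closed [simp]: "p \<in> carrier (poly_alg r) \<Longrightarrow> cls p \<in> carrier Q"
  by (simp add: carrier_Q)

lemma cls_add:
  assumes "p \<in> carrier (poly_alg r)" "q \<in> carrier (poly_alg r)"
  shows "cls p \<oplus>\<^bsub>Q\<^esub> cls q = cls (p + q)"
  using I.a_rcos_sum[OF assms] by (simp add: quot_alg_def FactRing_simps)

lemma cls_mult:
  assumes "p \<in> carrier (poly_alg r)" "q \<in> carrier (poly_alg r)"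
  shows "cls p \<otimes>\<^bsub>Q\<^esub> cls q = cls (p * q)"
  using I.rcoset_mult_add[OF assms] by (simp add: quot_alg_def FactRing_simps)

lemma zero_Q: "\<zero>\<^bsub>Q\<^esub> = cls 0"
  using P.a_rcos_zero[OF I.is_ideal I.zero_closed] by (simp add: quot_alg_def FactRing_simps)

lemma one_Q: "\<one>\<^bsub>Q\<^esub> = cls 1"
  by (simp add: quot_alg_def FactRing_simps)

lemma const_closed [simp]: "const c \<in> carrier (poly_alg r)"
  using const_in_poly_piece poly_piece_subset by blast

text \<open>The scalar multiple is defined as a union over all representatives. They all yield the
  same coset, so the union collapses, and scaling becomes ring multiplication by the class of a
  constant.\<close>

lemma cls_smult:
  assumes "p \<in> carrier (poly_alg r)"
  shows "c \<odot>\<^bsub>Q\<^esub> cls p = cls (const c) \<otimes>\<^bsub>Q\<^esub> cls p"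
proof -
  have "cls (const c * x) = cls (const c * p)" if "x \<in> cls p" for x
  proof -
    have x: "x \<in> carrier (poly_alg r)" by (rule I.a_elemrcos_carrier[OF assms that])
    moreover have "cls x = cls p"
      using I.a_repr_independence' [OF that] assms by simp
    ultimately show ?thesis
      by (metis assms cls_mult const_closed)
  qed
  moreover have "p \<in> cls p" using I.a_rcos_self[OF assms] .
  ultimately have "(\<Union>x\<in>cls p. cls (const c * x)) = cls (const c * p)"
    by blast
  moreover have "c \<odot>\<^bsub>Q\<^esub> cls p = (\<Union>x\<in>cls p. cls (const c * x))"
    by (simp add: quot_alg_def module.defs ring.defs)
  ultimately show ?thesis
    using cls_mult[OF const_closed assms] by simp
qed

lemma smult_Q: "a \<in> carrier Q \<Longrightarrow> c \<odot>\<^bsub>Q\<^esub> a = cls (const c) \<otimes>\<^bsub>Q\<^esub> a"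
  by (auto simp: carrier_Q cls_smult)

text \<open>With scaling expressed as multiplication by constants, the module axioms follow from the
  ring laws of \<open>Q\<close>.\<close>

lemma vectorspace_Q: "vectorspace class_ring Q"
proof -
  have "Module.module (class_ring :: 'k ring) Q"
  proof (rule moduleI)
    show "cring (class_ring :: 'k ring)" by (rule class_cring.is_cring)
    show "abelian_group Q" by (rule Q.abelian_group_axioms)
    fix c d :: 'k and a b assume a: "a \<in> carrier Q"
    show "c \<odot>\<^bsub>Q\<^esub> a \<in> carrier Q"
      using a by (simp add: smult_Q)
    show "(c \<oplus>\<^bsub>class_ring\<^esub> d) \<odot>\<^bsub>Q\<^esub> a = c \<odot>\<^bsub>Q\<^esub> a \<oplus>\<^bsub>Q\<^esub> d \<odot>\<^bsub>Q\<^esub> a"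
      using a by (simp add: smult_Q single_add cls_add[symmetric] Q.l_distr)
    show "(c \<otimes>\<^bsub>class_ring\<^esub> d) \<odot>\<^bsub>Q\<^esub> a = c \<odot>\<^bsub>Q\<^esub> (d \<odot>\<^bsub>Q\<^esub> a)"
      using a cls_mult[of "const c" "const d"]
      by (simp add: smult_Q mult_single Q.m_assoc[symmetric])
    show "\<one>\<^bsub>class_ring\<^esub> \<odot>\<^bsub>Q\<^esub> a = a"
      using a by (simp add: smult_Q one_Q[symmetric])
    assume b: "b \<in> carrier Q"
    show "c \<odot>\<^bsub>Q\<^esub> (a \<oplus>\<^bsub>Q\<^esub> b) = c \<odot>\<^bsub>Q\<^esub> a \<oplus>\<^bsub>Q\<^esub> c \<odot>\<^bsub>Q\<^esub> b"
      using a b by (simp add: smult_Q Q.r_distr)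
  qed
  then show ?thesis
    by (simp add: vectorspace_def class_field)
qed

sublocale QV: vectorspace class_ring Q by (rule vectorspace_Q)

section \<open>The graded pieces of the quotient\<close>

lemma quot_piece_subset: "quot_piece r I i \<subseteq> carrier Q"
  using poly_piece_subset[of r i] by (auto simp: quot_piece_def)

lemma quot_piece_closed: "a \<in> quot_piece r I i \<Longrightarrow> a \<in> carrier Q"
  using quot_piece_subset by auto

lemma quot_piece_mult:
  assumes "a \<in> quot_piece r I i" "b \<in> quot_piece r I k"
  shows "a \<otimes>\<^bsub>Q\<^esub> b \<in> quot_piece r I (i + k)"
proof -
  obtain p q where "p \<in> poly_piece r i" "a = cls p" "q \<in> poly_piece r k" "b = cls q"
    using assms by (auto simp: quot_piece_def)
  then show ?thesis
    using poly_piece_mult[of p r i q k] poly_piece_subset[of r i] poly_piece_subset[of r k]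
      cls_mult[of p q]
    by (auto simp: quot_piece_def)
qed

lemma quot_piece_add:
  assumes "a \<in> quot_piece r I i" "b \<in> quot_piece r I i"
  shows "a \<oplus>\<^bsub>Q\<^esub> b \<in> quot_piece r I i"
proof -
  obtain p q where "p \<in> poly_piece r i" "a = cls p" "q \<in> poly_piece r i" "b = cls q"
    using assms by (auto simp: quot_piece_def)
  then show ?thesis
    using poly_piece_add[of p r i q] poly_piece_subset[of r i] cls_add[of p q]
    by (auto simp: quot_piece_def)
qed

lemma quot_piece_smult:
  assumes "a \<in> quot_piece r I i"
  shows "c \<odot>\<^bsub>Q\<^esub> a \<in> quot_piece r I i"
  using quot_piece_mult[of "cls (const c)" 0 a i] assms const_in_poly_piece
  by (auto simp: smult_Q quot_piece_closed quot_piece_def)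

lemma zero_in_quot_piece: "\<zero>\<^bsub>Q\<^esub> \<in> quot_piece r I i"
  by (auto simp: quot_piece_def zero_Q)

lemma subspace_quot_piece: "subspace class_ring (quot_piece r I i) Q"
proof -
  have "LinearCombinations.submodule class_ring (quot_piece r I i) Q"
    by (rule LinearCombinations.submodule.intro)
      (auto simp: QV.module_axioms zero_in_quot_piece quot_piece_closed quot_piece_add
        quot_piece_smult)
  then show ?thesis by (simp add: subspace_def vectorspace_Q)
qed

text \<open>The space whose dimension defines \<open>hilb r I i\<close>.\<close>

abbreviation piece where "piece i \<equiv> QV.vs (quot_piece r I i)"

lemma vectorspace_piece: "vectorspace class_ring (piece i)"
  by (rule QV.subspace_is_vs[OF subspace_quot_piece])

text \<open>Negation is scaling by \<open>- 1\<close>, under which a piece is closed.\<close>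

lemma quot_piece_uminus:
  assumes "a \<in> quot_piece r I i"
  shows "\<ominus>\<^bsub>Q\<^esub> a \<in> quot_piece r I i"
  using QV.smult_l_minus[of 1 a] QV.smult_one[of a] quot_piece_smult[OF assms, of "- 1"]
    quot_piece_closed[OF assms]
  by (simp add: class_ring_simps)

lemma smult_mult_right:
  assumes "a \<in> carrier Q" "b \<in> carrier Q"
  shows "a \<otimes>\<^bsub>Q\<^esub> (c \<odot>\<^bsub>Q\<^esub> b) = c \<odot>\<^bsub>Q\<^esub> (a \<otimes>\<^bsub>Q\<^esub> b)"
  using assms by (simp add: smult_Q Q.m_lcomm)

text \<open>Homogeneity of \<open>I\<close> enters here: if \<open>p\<close> and \<open>q\<close>
  have different degrees and the same class, then \<open>p\<close> is a homogeneous component of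
  \<open>p - q\<close> and so lies in \<open>I\<close>.\<close>

lemma quot_piece_inter:
  assumes "a \<in> quot_piece r I i" "a \<in> quot_piece r I k" "i \<noteq> k"
  shows "a = \<zero>\<^bsub>Q\<^esub>"
proof -
  obtain p q where p: "p \<in> poly_piece r i" "a = cls p" and q: "q \<in> poly_piece r k" "a = cls q"
    using assms by (auto simp: quot_piece_def)
  have pc: "p \<in> carrier (poly_alg r)" "q \<in> carrier (poly_alg r)"
    using p q poly_piece_subset by auto
  then have "p - q \<in> I" using p q cls_eq_iff[OF pc] by simp
  then have "hom_component i (p - q) \<in> I"
    using homogeneous by (simp add: homogeneous_ideal_def)
  also have "hom_component i (p - q) = p"
  proof (rule poly_mapping_eqI)
    fix m
    have "Poly_Mapping.lookup p m = 0" if "mon_deg m \<noteq> i"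
      using that p by (auto simp: poly_piece_def in_keys_iff)
    moreover have "Poly_Mapping.lookup q m = 0" if "mon_deg m = i"
      using that q assms(3) by (auto simp: poly_piece_def in_keys_iff)
    ultimately show "Poly_Mapping.lookup (hom_component i (p - q)) m = Poly_Mapping.lookup p m"
      by (simp add: lookup_hom_component lookup_minus)
  qed
  finally show ?thesis
    using p pc cls_eq_iff[of p 0] P.zero_closed by (simp add: zero_Q)
qed

section \<open>Annihilators and the socle\<close>

lemma annihilator_ideal:
  assumes "a \<in> carrier Q"
  shows "ideal {b \<in> carrier Q. a \<otimes>\<^bsub>Q\<^esub> b = \<zero>\<^bsub>Q\<^esub>} Q" (is "ideal ?A Q")
proof (rule idealI)
  show "subgroup ?A (add_monoid Q)"
  proof (rule group.subgroupI[OF Q.a_group])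
    show "?A \<noteq> {}" using assms by auto
    show "inv\<^bsub>add_monoid Q\<^esub> b \<in> ?A" if "b \<in> ?A" for b
      using assms that by (simp add: Q.r_minus flip: a_inv_def)
  qed (use assms in \<open>auto simp: Q.r_distr\<close>)
next
  fix b x assume b: "b \<in> ?A" and x: "x \<in> carrier Q"
  then have "a \<otimes>\<^bsub>Q\<^esub> (b \<otimes>\<^bsub>Q\<^esub> x) = \<zero>\<^bsub>Q\<^esub>"
    using assms Q.m_assoc[of a b x] by simp
  then show "b \<otimes>\<^bsub>Q\<^esub> x \<in> ?A" "x \<otimes>\<^bsub>Q\<^esub> b \<in> ?A"
    using b x by (simp_all add: Q.m_comm[of x b])
qed (rule Q.ring_axioms)

text \<open>The annihilator of \<open>a\<close> is an ideal, so it contains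
  \<open>max_hom_ideal r I\<close> once it contains the generators, the elements of positive
  degree.\<close>

lemma in_socleI:
  assumes "a \<in> carrier Q"
    and "\<And>i b. 1 \<le> i \<Longrightarrow> b \<in> quot_piece r I i \<Longrightarrow> a \<otimes>\<^bsub>Q\<^esub> b = \<zero>\<^bsub>Q\<^esub>"
  shows "a \<in> socle r I"
proof -
  have "max_hom_ideal r I \<subseteq> {b \<in> carrier Q. a \<otimes>\<^bsub>Q\<^esub> b = \<zero>\<^bsub>Q\<^esub>}"
    unfolding max_hom_ideal_def
    by (rule Q.genideal_minimal[OF annihilator_ideal[OF assms(1)]])
      (use assms quot_piece_closed in auto)
  then show ?thesis using assms(1) by (auto simp: socle_def)
qed

end

section \<open>Two variables\<close>

locale graded_quotient2 = graded_quotient 2 I for I :: "'k::field mpoly set"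
begin

definition X where "X = cls (var 0)"
definition Y where "Y = cls (var 1)"

lemma XY_piece: "X \<in> quot_piece 2 I 1" "Y \<in> quot_piece 2 I 1"
  unfolding X_def Y_def quot_piece_def by (rule imageI, rule var_in_poly_piece, simp)+

lemmas XY_closed [simp] = XY_piece[THEN quot_piece_closed]

lemma XY_mult:
  assumes "a \<in> quot_piece 2 I i"
  shows "X \<otimes>\<^bsub>Q\<^esub> a \<in> quot_piece 2 I (Suc i)" "Y \<otimes>\<^bsub>Q\<^esub> a \<in> quot_piece 2 I (Suc i)"
  using XY_piece[THEN quot_piece_mult, OF assms] by simp_all

lemma quot_piece_Suc_decompose:
  assumes "a \<in> quot_piece 2 I (Suc i)"
  obtains b c where "b \<in> quot_piece 2 I i" "c \<in> quot_piece 2 I i"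
    "a = X \<otimes>\<^bsub>Q\<^esub> b \<oplus>\<^bsub>Q\<^esub> Y \<otimes>\<^bsub>Q\<^esub> c"
proof -
  obtain p where p: "p \<in> poly_piece 2 (Suc i)" "a = cls p"
    using assms by (auto simp: quot_piece_def)
  obtain q s where qs: "q \<in> poly_piece 2 i" "s \<in> poly_piece 2 i" "p = var 0 * q + var 1 * s"
    using poly_piece_Suc_decompose[OF p(1)] .
  have "(var v :: 'k mpoly) \<in> carrier (poly_alg 2)" if "v < 2" for v
    using var_in_poly_piece[OF that] poly_piece_subset by blast
  from this[of 0] this[of 1]
  have "(var 0 :: 'k mpoly) \<in> carrier (poly_alg 2)" "(var 1 :: 'k mpoly) \<in> carrier (poly_alg 2)"
    by simp_all
  moreover have "q \<in> carrier (poly_alg 2)" "s \<in> carrier (poly_alg 2)"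
    using qs poly_piece_subset by auto
  ultimately have "a = X \<otimes>\<^bsub>Q\<^esub> cls q \<oplus>\<^bsub>Q\<^esub> Y \<otimes>\<^bsub>Q\<^esub> cls s"
    by (simp add: X_def Y_def p qs(3) cls_mult cls_add poly_alg_mult_closed)
  then show ?thesis using qs that by (auto simp: quot_piece_def)
qed

text \<open>These are the differentials of the Koszul complex of \<open>X\<close> and
  \<open>Y\<close> on \<open>Q\<close>; one pair of functions serves all degrees. The sign makes the
  composite \<open>X Y a - Y X a\<close> vanish.\<close>

definition left_map where "left_map a = (Y \<otimes>\<^bsub>Q\<^esub> a, \<ominus>\<^bsub>Q\<^esub> (X \<otimes>\<^bsub>Q\<^esub> a))"
definition right_map where "right_map v = X \<otimes>\<^bsub>Q\<^esub> fst v \<oplus>\<^bsub>Q\<^esub> Y \<otimes>\<^bsub>Q\<^esub> snd v"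

lemma linear_left_map:
  "linear_map class_ring (piece i) (direct_sum (piece (Suc i)) (piece (Suc i))) left_map"
  by (rule linear_mapI)
    (simp_all add: mem_Times_iff left_map_def vectorspace_piece direct_sum_is_vs XY_mult quot_piece_uminus
      quot_piece_closed Q.r_distr Q.minus_add smult_mult_right QV.smult_r_minus)

lemma linear_right_map:
  "linear_map class_ring (direct_sum (piece i) (piece i)) (piece (Suc i)) right_map"
  by (rule linear_mapI)
    (simp_all add: mem_Times_iff right_map_def vectorspace_piece direct_sum_is_vs XY_mult quot_piece_add
      quot_piece_closed[of _ i] Q.r_distr Q.a_ac smult_mult_right QV.smult_r_distr)

lemma right_map_surj:
  "right_map ` carrier (direct_sum (piece i) (piece i)) = carrier (piece (Suc i))"
proof
  show "right_map ` carrier (direct_sum (piece i) (piece i)) \<subseteq> carrier (piece (Suc i))"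
    by (auto simp: right_map_def XY_mult quot_piece_add)
  show "carrier (piece (Suc i)) \<subseteq> right_map ` carrier (direct_sum (piece i) (piece i))"
  proof
    fix a assume "a \<in> carrier (piece (Suc i))"
    then have "a \<in> quot_piece 2 I (Suc i)" by simp
    then obtain b c where "b \<in> quot_piece 2 I i" "c \<in> quot_piece 2 I i"
      "a = X \<otimes>\<^bsub>Q\<^esub> b \<oplus>\<^bsub>Q\<^esub> Y \<otimes>\<^bsub>Q\<^esub> c"
      by (rule quot_piece_Suc_decompose)
    then show "a \<in> right_map ` carrier (direct_sum (piece i) (piece i))"
      by (intro image_eqI[of _ _ "(b, c)"]) (auto simp: right_map_def)
  qed
qed

lemma right_left_map: "a \<in> carrier Q \<Longrightarrow> right_map (left_map a) = \<zero>\<^bsub>Q\<^esub>"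
  by (simp add: right_map_def left_map_def Q.r_minus Q.m_lcomm[of Y X] Q.r_neg)

text \<open>Rank-nullity and the dimension formulas require finite dimension. By induction, the
  class of \<open>1\<close> spans degree 0, and each next piece is the image of two copies of the
  preceding one.\<close>

lemma fin_dim_piece: "vectorspace.fin_dim class_ring (piece i)"
proof (induction i)
  case 0
  interpret V: vectorspace class_ring "piece 0" by (rule vectorspace_piece)
  have one: "cls 1 \<in> carrier (piece 0)"
    using const_in_poly_piece[of 1] by (auto simp: quot_piece_def)
  interpret S: LinearCombinations.submodule class_ring "V.span {cls 1}" "piece 0"
    by (rule V.span_is_submodule) (use one in simp)
  have "a \<in> V.span {cls 1}" if a: "a \<in> carrier (piece 0)" for a
  proof -
    obtain p where p: "p \<in> poly_piece 2 0" "a = cls p"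
      using a by (auto simp: quot_piece_def)
    then obtain c where "a = cls (const c)" using poly_piece_0_const[OF p(1)] by metis
    then have "a = c \<odot>\<^bsub>piece 0\<^esub> cls 1"
      by (simp add: smult_Q flip: one_Q)
    then show ?thesis
      using S.smult_closed[of c "cls 1"] V.in_own_span[of "{cls 1}"] one by simp
  qed
  then have "V.span {cls 1} = carrier (piece 0)" using S.subset by blast
  then show ?case
    unfolding V.fin_dim_def using one by blast
next
  case (Suc i)
  interpret g: linear_map class_ring "direct_sum (piece i) (piece i)" "piece (Suc i)" right_map
    by (rule linear_right_map)
  show ?case
    by (rule g.surj_fin_dim[OF _ right_map_surj])
      (intro direct_sum_fin_dim vectorspace_piece Suc.IH)
qed

text \<open>Every element of positive degree has the form \<open>X c + Y d\<close>, so annihilation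
  by the two variables suffices.\<close>

lemma in_socle2I:
  assumes "a \<in> carrier Q" "X \<otimes>\<^bsub>Q\<^esub> a = \<zero>\<^bsub>Q\<^esub>" "Y \<otimes>\<^bsub>Q\<^esub> a = \<zero>\<^bsub>Q\<^esub>"
  shows "a \<in> socle 2 I"
proof (rule in_socleI[OF assms(1)])
  fix i b assume "1 \<le> i" "b \<in> quot_piece 2 I i"
  then obtain c d where cd: "c \<in> carrier Q" "d \<in> carrier Q" "b = X \<otimes>\<^bsub>Q\<^esub> c \<oplus>\<^bsub>Q\<^esub> Y \<otimes>\<^bsub>Q\<^esub> d"
    using quot_piece_Suc_decompose[of b "i - 1"] quot_piece_closed
    by (metis Suc_diff_1 less_eq_Suc_le One_nat_def)
  have "a \<otimes>\<^bsub>Q\<^esub> b = (X \<otimes>\<^bsub>Q\<^esub> a) \<otimes>\<^bsub>Q\<^esub> c \<oplus>\<^bsub>Q\<^esub> (Y \<otimes>\<^bsub>Q\<^esub> a) \<otimes>\<^bsub>Q\<^esub> d"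
    using assms(1) cd by (simp add: Q.r_distr Q.m_ac)
  then show "a \<otimes>\<^bsub>Q\<^esub> b = \<zero>\<^bsub>Q\<^esub>" using assms cd by simp
qed

text \<open>This says that the second difference of the Hilbert function is nonpositive. Levelness
  puts the kernel of \<open>left_map\<close> on degree \<open>i\<close> into degree \<open>j\<close>
  as well, so it is zero, and the dimension count for the complex applies.\<close>

lemma hilb_add_le:
  assumes "socle 2 I = quot_piece 2 I j" "i < j"
  shows "hilb 2 I i + hilb 2 I (Suc (Suc i)) \<le> 2 * hilb 2 I (Suc i)"
proof -
  let ?V = "piece (Suc i)"
  interpret f: linear_map class_ring "piece i" "direct_sum ?V ?V" left_map
    by (rule linear_left_map)
  \<comment> \<open>A kernel element is killed by \<open>X\<close> and \<open>Y\<close>, hence is in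
    the socle; \<open>i < j\<close> then forces it to vanish.\<close>
  have "a = \<zero>\<^bsub>Q\<^esub>" if a: "a \<in> quot_piece 2 I i" "left_map a = (\<zero>\<^bsub>Q\<^esub>, \<zero>\<^bsub>Q\<^esub>)" for a
  proof -
    have "X \<otimes>\<^bsub>Q\<^esub> a = \<zero>\<^bsub>Q\<^esub>" "Y \<otimes>\<^bsub>Q\<^esub> a = \<zero>\<^bsub>Q\<^esub>"
      using a quot_piece_closed[OF a(1)] Q.minus_minus[of "X \<otimes>\<^bsub>Q\<^esub> a"] by (simp_all add: mem_Times_iff left_map_def)
    then have "a \<in> quot_piece 2 I j"
      using in_socle2I quot_piece_closed[OF a(1)] assms(1) by auto
    then show ?thesis using quot_piece_inter a(1) assms(2) by blast
  qed
  then have inj: "inj_on left_map (carrier (piece i))"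
    by (intro f.Ke0_imp_inj) (auto simp: f.ker_def zero_in_quot_piece left_map_def)
  have "vectorspace.dim class_ring (piece i) + vectorspace.dim class_ring (piece (Suc (Suc i)))
      \<le> vectorspace.dim class_ring (direct_sum ?V ?V)"
    by (rule dim_add_le_of_complex[OF _ linear_left_map linear_right_map _ _ inj right_map_surj])
      (auto simp: right_left_map quot_piece_closed fin_dim_piece
        intro!: direct_sum_is_vs vectorspace_piece direct_sum_fin_dim)
  then show ?thesis
    by (simp add: hilb_def direct_sum_dim vectorspace_piece fin_dim_piece)
qed

end

lemma level_log_concave:
  assumes "level_algebra 2 I j t"
  shows "log_concave (hilb 2 I) j"
  unfolding log_concave_def
proof (intro allI impI)
  fix i assume i: "1 \<le> i \<and> i < j"
  interpret graded_quotient2 I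
    using assms by unfold_locales (simp add: level_algebra_def)
  obtain k where k: "i = Suc k" using i by (cases i) auto
  have "socle 2 I = quot_piece 2 I j" using assms by (simp add: level_algebra_def)
  \<comment> \<open>The complex starts in degree \<open>k = i - 1\<close>, so that its middle term
    has degree \<open>i\<close>.\<close>
  then have "hilb 2 I (i - 1) + hilb 2 I (i + 1) \<le> 2 * hilb 2 I i"
    using hilb_add_le[of j k] i by (simp add: k)
  then show "hilb 2 I (i - 1) * hilb 2 I (i + 1) \<le> (hilb 2 I i)\<^sup>2"
    by (rule mult_le_square_if_add_le)
qed

theorem proposition4p3:
  assumes "infinite (UNIV :: 'k::field set)"
  shows "(\<forall>(I :: 'k mpoly set) j t.
            level_algebra 2 I j t \<and> hilb 2 I 1 = 2 \<longrightarrow> log_concave (hilb 2 I) j) \<and>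
         (\<forall>r (I :: 'k mpoly set) j t.
            compressed_level_algebra r I j t \<longrightarrow> log_concave (hilb r I) j)"
  using level_log_concave compressed_log_concave by blast

end
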